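(* Let $f(D)$ be a differential operator of degree one, and let $(p_a^\alpha(x))$ be its associated graded sequence. Then for all integers $a$ and all logarithmic indices $\alpha$, $$p_a^\alpha(x)=f'(D)\left(\frac{D}{f(D)}\right)^{a+1}\lambda_a^\alpha(x),$$ where $f'(D)$ is the Pincherle derivative. In particular, $p_{-1}^{(1)}(x)=f'(D)\,x^{-1}$.
   Context: Setting (discrete case of the logarithmic umbral calculus). For $a\in\mathbb{Z}$ let $\lfloor a\rceil=a$ if $a\neq0$, $\lfloor 0\rceil=1$; $\lfloor a\rceil!=a!$ for $a\ge0$, $\lfloor a\rceil!=(-1)^{-a-1}/(-a-1)!$ for $a<0$. Harmonic logarithms $\lambda_a^\alpha(x)$ ($a\in\mathbb{Z}$, $\alpha$ a logarithmic index): $\lambda_a^{(0)}=x^a$ for $a\ge0$, $0$ for $a<0$; $\lambda_a^{(1)}=x^a(\log x-H_a)$ for $a\ge0$, $x^a$ for $a<0$ (so $\lambda_{-1}^{(1)}=x^{-1}$); higher indices involve iterated logarithms. $\mathcal{I}^\alpha$: formal series $\sum_{b\le N}c_b\lambda_b^\alpha$. $D\lambda_a^\alpha=\lfloor a\rceil\lambda_{a-1}^\alpha$; Artinian operators $\sum_{a\ge k}c_aD^a$ act via $D^b\lambda_a^\alpha=\frac{\lfloor a\rceil!}{\lfloor a-b\rceil!}\lambda_{a-b}^\alpha$; differential operators are those $\sum_{a\ge0}c_aD^a$; the degree is the least $a$ with $c_a\ne0$; a delta operator is one of degree one; the Pincherle derivative of $\sum c_aD^a$ is $\sum ac_aD^{a-1}$.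 $\langle\alpha\mid p\rangle$ = coefficient of $\lambda_0^\alpha$ in $p$. A graded sequence is a regular family $(p_a^\alpha)$, $p_a^\alpha\in\mathcal{I}^\alpha$ of degree $a$ (coefficients independent of $\alpha\ne(0)$; $p_a^{(0)}$ obtained from $p_a^{(1)}$ by $\lambda_b^{(1)}\mapsto\lambda_b^{(0)}$). The associated graded sequence of a delta operator $f(D)$ is the unique graded sequence with $\langle\alpha\mid p_0^\alpha\rangle=1$, $\langle\alpha\mid p_a^\alpha\rangle=0$ ($a\ne0$), $f(D)p_a^\alpha=\lfloor a\rceil p_{a-1}^\alpha$. *)

theory Defs
  imports
    "HOL-Computational_Algebra.Formal_Laurent_Series"
    "HOL-Library.Poly_Mapping"
begin

section \<open>Formal series in iterated logarithms\<close>

text \<open>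
  A logarithmic index is a finitely supported integer sequence. The index \<open>\<alpha>\<close> stands for
  the product of the \<open>(i+1)\<close>-fold iterated logarithms of \<open>x\<close> to the powers \<open>lookup \<alpha> i\<close>; this
  product is written \<open>L^\<alpha>\<close> below. The indices called (0) and (1) in the literature are
  \<open>0\<close> and \<open>log_index_one\<close>. In a series, \<open>p b \<beta>\<close> is the coefficient of \<open>x^b L^\<beta>\<close>.
\<close>

type_synonym log_index = "nat \<Rightarrow>\<^sub>0 int"
type_synonym 'a log_series = "int \<Rightarrow> log_index \<Rightarrow> 'a"

definition log_index_one :: log_index where
  "log_index_one = Poly_Mapping.single 0 1"

definition log_monom :: "int \<Rightarrow> log_index \<Rightarrow> 'a::field_char_0 log_series" where
  "log_monom b \<beta> = (\<lambda>b' \<beta>'. if b' = b \<and> \<beta>' = \<beta> then 1 else 0)"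

text \<open>
  The Euler derivation \<open>x d/dx\<close> on finite combinations of the \<open>L^\<alpha>\<close>. It sends the
  \<open>(i+1)\<close>-fold iterated logarithm to the inverse of the product of the first \<open>i\<close> iterated
  logarithms, so that \<open>L^\<alpha>\<close> goes to the sum of \<open>\<alpha>_i L^(\<alpha> - index_upto i)\<close>.
\<close>

definition index_upto :: "nat \<Rightarrow> log_index" where
  "index_upto i = (\<Sum>j\<le>i. Poly_Mapping.single j 1)"

definition euler_log :: "(log_index \<Rightarrow>\<^sub>0 'a::field_char_0) \<Rightarrow> (log_index \<Rightarrow>\<^sub>0 'a)" where
  "euler_log P = (\<Sum>\<alpha>\<in>Poly_Mapping.keys P. \<Sum>i\<in>Poly_Mapping.keys \<alpha>.
     Poly_Mapping.single (\<alpha> - index_upto i)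
       (Poly_Mapping.lookup P \<alpha> * of_int (Poly_Mapping.lookup \<alpha> i)))"

text \<open>
  The derivation \<open>D = d/dx\<close> on series; it satisfies
  \<open>D (x^b L^\<beta>) = x^(b-1) (b L^\<beta> + euler_log (L^\<beta>))\<close>.
\<close>

definition log_deriv :: "'a::field_char_0 log_series \<Rightarrow> 'a log_series" where
  "log_deriv p = (\<lambda>b \<beta>. of_int (b + 1) * p (b + 1) \<beta> +
     (\<Sum>i | p (b + 1) (\<beta> + index_upto i) \<noteq> 0.
        of_int (Poly_Mapping.lookup \<beta> i + 1) * p (b + 1) (\<beta> + index_upto i)))"


section \<open>Roman factorials and harmonic logarithms\<close>

definition roman :: "int \<Rightarrow> int" where
  "roman a = (if a = 0 then 1 else a)"

definition roman_fact :: "int \<Rightarrow> 'a::field_char_0" where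
  "roman_fact a = (if a \<ge> 0 then fact (nat a) else (- 1) ^ nat (- a - 1) / fact (nat (- a - 1)))"

text \<open>
  The harmonic logarithms are determined by \<open>\<lambda>_0 = L^\<alpha>\<close> and \<open>D \<lambda>_a = roman a \<lambda>_(a-1)\<close>.
  Writing \<open>\<lambda>_a = x^a g_a\<close> and \<open>\<theta> = euler_log\<close>, the latter says \<open>(a + \<theta>) g_a = roman a g_(a-1)\<close>.
  Hence \<open>g_a = G_a(\<theta>) L^\<alpha>\<close>, where \<open>G_a\<close> is the product of the \<open>(1 + X/i)^(-1)\<close> over
  \<open>1 \<le> i \<le> a\<close> if \<open>a \<ge> 0\<close>, and \<open>X\<close> times the product of the \<open>1 - X/i\<close> over \<open>1 \<le> i < -a\<close>
  if \<open>a < 0\<close>.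
\<close>

definition harm_log_gen :: "int \<Rightarrow> 'a::field_char_0 fps" where
  "harm_log_gen a =
     (if a \<ge> 0 then (\<Prod>i=1..nat a. inverse (1 + fps_const (1 / of_nat i) * fps_X))
      else fps_X * (\<Prod>i=1..nat (- a - 1). 1 - fps_const (1 / of_nat i) * fps_X))"

text \<open>
  Each application of \<open>\<theta>\<close> lowers the exponent of \<open>log x\<close> by exactly one, so
  only the term with \<open>k = lookup \<alpha> 0 - lookup \<beta> 0\<close> of \<open>G_a(\<theta>) L^\<alpha>\<close> involves \<open>L^\<beta>\<close>.
\<close>

definition harm_log :: "int \<Rightarrow> log_index \<Rightarrow> 'a::field_char_0 log_series" where
  "harm_log a \<alpha> = (\<lambda>b \<beta>. if b = a then
     (let k = nat (Poly_Mapping.lookup \<alpha> 0 - Poly_Mapping.lookup \<beta> 0) in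
        fps_nth (harm_log_gen a) k *
        Poly_Mapping.lookup ((euler_log ^^ k) (Poly_Mapping.single \<alpha> 1)) \<beta>)
     else 0)"

lemma lookup_index_upto: "Poly_Mapping.lookup (index_upto i) j = (if j \<le> i then 1 else 0)"
  by (simp add: index_upto_def lookup_sum lookup_single when_def)

lemma lookup_euler_log:
  "Poly_Mapping.lookup (euler_log P) \<beta> =
     (\<Sum>i | Poly_Mapping.lookup P (\<beta> + index_upto i) \<noteq> 0.
        of_int (Poly_Mapping.lookup \<beta> i + 1) * Poly_Mapping.lookup P (\<beta> + index_upto i))"
proof -
  let ?I = "{i. Poly_Mapping.lookup P (\<beta> + index_upto i) \<noteq> 0}"
  let ?S = "Sigma (Poly_Mapping.keys P) Poly_Mapping.keys"
  let ?h = "\<lambda>\<alpha> i. Poly_Mapping.lookup P \<alpha> * of_int (Poly_Mapping.lookup \<alpha> i)"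
  have inj: "inj_on (\<lambda>i. (\<beta> + index_upto i, i)) ?I"
    by (auto simp: inj_on_def)
  have "inj index_upto"
  proof (rule injI)
    fix i j assume "index_upto i = index_upto j"
    then have "Poly_Mapping.lookup (index_upto i) k = Poly_Mapping.lookup (index_upto j) k" for k
      by simp
    from this[of i] this[of j] show "i = j"
      by (auto simp: lookup_index_upto split: if_splits)
  qed
  then have "inj (\<lambda>i. \<beta> + index_upto i)"
    by (auto simp: inj_def)
  then have fin: "finite ?I"
    using finite_vimageI[of "Poly_Mapping.keys P" "\<lambda>i. \<beta> + index_upto i"]
    by (simp add: vimage_def in_keys_iff)
  have "Poly_Mapping.lookup (euler_log P) \<beta> =
      (\<Sum>\<alpha>\<in>Poly_Mapping.keys P. \<Sum>i\<in>Poly_Mapping.keys \<alpha>.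
         if \<alpha> = \<beta> + index_upto i then ?h \<alpha> i else 0)"
    by (simp add: euler_log_def lookup_sum lookup_single when_def algebra_simps)
  also have "\<dots> = (\<Sum>z\<in>?S. if fst z = \<beta> + index_upto (snd z) then ?h (fst z) (snd z) else 0)"
    by (subst sum.Sigma) (auto simp: case_prod_unfold)
  also have "\<dots> = sum (\<lambda>z. ?h (fst z) (snd z)) {z\<in>?S. fst z = \<beta> + index_upto (snd z)}"
    by (subst sum.inter_filter) auto
  also have "\<dots> = sum (\<lambda>z. ?h (fst z) (snd z)) ((\<lambda>i. (\<beta> + index_upto i, i)) ` ?I)"
    using fin
    by (intro sum.mono_neutral_left) (auto simp: in_keys_iff)
  also have "\<dots> = (\<Sum>i\<in>?I. ?h (\<beta> + index_upto i) i)"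
    by (subst sum.reindex[OF inj]) simp
  finally show ?thesis
    by (simp add: lookup_add lookup_index_upto mult.commute)
qed

lemma euler_log_pow_exponent:
  "Poly_Mapping.lookup ((euler_log ^^ k) (Poly_Mapping.single \<alpha> (1::'a::field_char_0))) \<beta> \<noteq> 0 \<Longrightarrow>
     Poly_Mapping.lookup \<beta> 0 = Poly_Mapping.lookup \<alpha> 0 - int k"
proof (induction k arbitrary: \<beta>)
  case 0
  then show ?case by (auto simp: lookup_single when_def split: if_splits)
next
  case (Suc k)
  let ?P = "(euler_log ^^ k) (Poly_Mapping.single \<alpha> (1::'a))"
  from Suc.prems obtain i where "Poly_Mapping.lookup ?P (\<beta> + index_upto i) \<noteq> 0"
    by (auto simp: lookup_euler_log elim!: sum.not_neutral_contains_not_neutral)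
  from Suc.IH[OF this] show ?case
    by (simp add: lookup_add lookup_index_upto)
qed

lemma harm_log_gen_rec:
  "(of_int a + fps_X) * harm_log_gen a = of_int (roman a) * (harm_log_gen (a - 1) :: 'a::field_char_0 fps)"
proof -
  consider "a > 0" | "a = 0" | "a < 0" by linarith
  then show ?thesis
  proof cases
    case 1
    define n where "n = nat (a - 1)"
    have a: "a = int (Suc n)" using 1 by (simp add: n_def)
    let ?u = "1 + fps_const (1 / of_nat (Suc n)) * fps_X :: 'a fps"
    have *: "of_int a + fps_X = of_nat (Suc n) * ?u"
      by (simp add: a distrib_left fps_of_nat[symmetric] mult.assoc[symmetric] del: of_nat_Suc)
    have a': "a - 1 = int n" using a by simp
    have "harm_log_gen a = harm_log_gen (a - 1) * inverse ?u"
      unfolding a' unfolding a by (simp add: harm_log_gen_def del: of_nat_Suc)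
    moreover have "?u * inverse ?u = 1"
      by (subst mult.commute, rule inverse_mult_eq_1) simp
    ultimately have "?u * harm_log_gen a = harm_log_gen (a - 1)"
      by (simp only: mult.left_commute[of ?u] mult_1_right)
    then show ?thesis
      unfolding * mult.assoc using 1 by (simp add: roman_def a)
  next
    case 2
    then show ?thesis by (simp add: harm_log_gen_def roman_def)
  next
    case 3
    define n where "n = nat (- a - 1)"
    have a: "a = - int (Suc n)" using 3 by (simp add: n_def)
    let ?u = "1 - fps_const (1 / of_nat (Suc n)) * fps_X :: 'a fps"
    have *: "of_int a + fps_X = of_int a * ?u"
      by (simp add: a right_diff_distrib fps_of_nat[symmetric] mult.assoc[symmetric] del: of_nat_Suc)
    have a': "a - 1 = - int (Suc (Suc n))" using a by simp
    have nat_eq: "nat (- (- int (Suc m)) - 1) = m" for m by simp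
    have "harm_log_gen (a - 1) = harm_log_gen a * ?u"
      unfolding a' unfolding a
      by (simp add: harm_log_gen_def nat_eq mult.assoc del: of_nat_Suc minus_minus)
    then show ?thesis
      unfolding * using 3 by (simp add: roman_def mult_ac)
  qed
qed

theorem log_deriv_harm_log:
  "log_deriv (harm_log a \<alpha>) =
     (\<lambda>b \<beta>. of_int (roman a) * (harm_log (a - 1) \<alpha> b \<beta> :: 'a::field_char_0))"
proof (intro ext)
  fix b \<beta>
  let ?L = "\<lambda>k. (euler_log ^^ k) (Poly_Mapping.single \<alpha> (1::'a))"
  let ?G = "harm_log_gen a :: 'a fps" and ?H = "harm_log_gen (a - 1) :: 'a fps"
  show "log_deriv (harm_log a \<alpha>) b \<beta> = of_int (roman a) * (harm_log (a - 1) \<alpha> b \<beta> :: 'a)"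
  proof (cases "b = a - 1")
    case False
    then have "harm_log a \<alpha> (b + 1) = (\<lambda>_. 0 :: 'a)"
      by (auto simp: harm_log_def)
    with False show ?thesis by (simp add: log_deriv_def harm_log_def)
  next
    case True
    define d where "d = Poly_Mapping.lookup \<alpha> 0 - Poly_Mapping.lookup \<beta> 0"
    have rec: "of_int a * fps_nth ?G k + (if k = 0 then 0 else fps_nth ?G (k - 1)) =
        of_int (roman a) * fps_nth ?H k" for k
    proof -
      have "fps_nth ((of_int a + fps_X) * ?G) k = fps_nth (of_int (roman a) * ?H) k"
        by (simp only: harm_log_gen_rec)
      then show ?thesis
        by (simp add: distrib_right fps_of_int[symmetric] del: fps_of_int)
    qed
    have shifted: "harm_log a \<alpha> a (\<beta> + index_upto i) =
        fps_nth ?G (nat (d - 1)) * Poly_Mapping.lookup (?L (nat (d - 1))) (\<beta> + index_upto i)" for i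
      by (simp add: harm_log_def Let_def d_def lookup_add lookup_index_upto algebra_simps)
    have "(\<Sum>i | harm_log a \<alpha> a (\<beta> + index_upto i) \<noteq> (0::'a).
        of_int (Poly_Mapping.lookup \<beta> i + 1) * harm_log a \<alpha> a (\<beta> + index_upto i)) =
      fps_nth ?G (nat (d - 1)) * Poly_Mapping.lookup (euler_log (?L (nat (d - 1)))) \<beta>"
      by (cases "fps_nth ?G (nat (d - 1)) = 0")
         (simp_all add: shifted lookup_euler_log sum_distrib_left mult_ac)
    then have *: "log_deriv (harm_log a \<alpha>) b \<beta> =
        of_int a * (fps_nth ?G (nat d) * Poly_Mapping.lookup (?L (nat d)) \<beta>) +
        fps_nth ?G (nat (d - 1)) * Poly_Mapping.lookup (?L (Suc (nat (d - 1)))) \<beta>"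
      using True by (simp add: log_deriv_def harm_log_def Let_def d_def)
    have rhs: "harm_log (a - 1) \<alpha> b \<beta> = fps_nth ?H (nat d) * Poly_Mapping.lookup (?L (nat d)) \<beta>"
      using True by (simp add: harm_log_def Let_def d_def)
    show ?thesis
    proof (cases "d \<ge> 1")
      case True
      define k where "k = nat (d - 1)"
      with True have k: "nat d = Suc k" "nat (d - 1) = k"
        by simp_all
      show ?thesis
        unfolding * rhs k 
        using arg_cong[OF rec[of "Suc k"],
          of "\<lambda>z. z * Poly_Mapping.lookup (?L (Suc k)) \<beta>"]
        by (simp add: algebra_simps)
    next
      case False
      then have "Poly_Mapping.lookup (?L (Suc (nat (d - 1)))) \<beta> = 0"
        using euler_log_pow_exponent[of "Suc (nat (d - 1))" \<alpha> \<beta>] by (force simp: d_def)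
      with False show ?thesis
        unfolding * rhs using rec[of 0] by (simp add: algebra_simps)
    qed
  qed
qed

lemma prod_nth_0: "fps_nth (prod g A) 0 = (\<Prod>i\<in>A. fps_nth (g i) 0 :: 'a::field_char_0)"
  by (induction A rule: infinite_finite_induct) simp_all

lemma harm_log_index_zero:
  "harm_log a 0 = (if a \<ge> 0 then log_monom a 0 else (\<lambda>_ _. 0 :: 'a::field_char_0))"
proof (intro ext)
  fix b \<beta>
  have "euler_log (Poly_Mapping.single 0 (1::'a)) = 0" "euler_log (0 :: log_index \<Rightarrow>\<^sub>0 'a) = 0"
    by (simp_all add: euler_log_def)
  then have pow: "(euler_log ^^ k) (Poly_Mapping.single 0 (1::'a)) =
      (if k = 0 then Poly_Mapping.single 0 1 else 0)" for k
    by (induction k) simp_all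
  have "fps_nth (harm_log_gen a) 0 = (if a \<ge> 0 then 1 else 0 :: 'a)"
    by (simp add: harm_log_gen_def prod_nth_0)
  then show "harm_log a 0 b \<beta> =
      (if a \<ge> 0 then log_monom a 0 else (\<lambda>_ _. 0 :: 'a)) b \<beta>"
    by (auto simp: harm_log_def Let_def pow log_monom_def lookup_single when_def simp del: single_one)
qed

lemma harm_log_index_one:
  "harm_log a log_index_one =
     (if a \<ge> 0 then
        (\<lambda>b \<beta>. log_monom a log_index_one b \<beta> - (\<Sum>i=1..nat a. 1 / of_nat i) * log_monom a 0 b \<beta>)
      else (log_monom a 0 :: 'a::field_char_0 log_series))"
proof (intro ext)
  fix b \<beta>
  let ?G = "harm_log_gen a :: 'a fps"
  have ne: "log_index_one \<noteq> 0"
    using lookup_single_eq[of 0 "1 :: int"] unfolding log_index_one_def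
    by (intro notI) simp
  have one: "Poly_Mapping.lookup log_index_one 0 = 1" "index_upto 0 = log_index_one"
    "Poly_Mapping.keys log_index_one = {0}"
    by (simp_all add: log_index_one_def index_upto_def)
  have "euler_log (Poly_Mapping.single log_index_one (1::'a)) = Poly_Mapping.single 0 1"
    "euler_log (Poly_Mapping.single 0 (1::'a)) = 0" "euler_log (0 :: log_index \<Rightarrow>\<^sub>0 'a) = 0"
    by (simp_all add: euler_log_def one)
  then have pow: "(euler_log ^^ k) (Poly_Mapping.single log_index_one (1::'a)) =
      (if k = 0 then Poly_Mapping.single log_index_one 1
       else if k = 1 then Poly_Mapping.single 0 1 else 0)" for k
    by (induction k) (simp_all split: if_splits)
  have inv1: "fps_nth (inverse (1 + fps_const c * fps_X)) (Suc 0) = (- c :: 'a)" for c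
  proof -
    let ?u = "1 + fps_const c * fps_X :: 'a fps"
    have "inverse ?u * ?u = 1"
      by (rule inverse_mult_eq_1) simp
    then have "fps_nth (inverse ?u * ?u) (Suc 0) = 0"
      by (simp only: fps_one_nth) simp
    then show ?thesis
      by (simp add: eq_neg_iff_add_eq_0 add.commute)
  qed
  have prod1: "fps_nth (\<Prod>i=1..n. inverse (1 + fps_const (1 / of_nat i) * fps_X)) (Suc 0) =
      - (\<Sum>i=1..n. 1 / of_nat i :: 'a)" for n
    by (induction n) (simp_all add: fps_mult_nth_1' prod_nth_0 inv1)
  have G0: "fps_nth ?G 0 = (if a \<ge> 0 then 1 else 0)"
    by (simp add: harm_log_gen_def prod_nth_0)
  have G1: "fps_nth ?G (Suc 0) = (if a \<ge> 0 then - (\<Sum>i=1..nat a. 1 / of_nat i) else 1)"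
    using prod1[of "nat a"] by (simp add: harm_log_gen_def prod_nth_0)
  show "harm_log a log_index_one b \<beta> = (if a \<ge> 0 then
        (\<lambda>b \<beta>. log_monom a log_index_one b \<beta> - (\<Sum>i=1..nat a. 1 / of_nat i) * log_monom a 0 b \<beta>)
      else (log_monom a 0 :: 'a log_series)) b \<beta>"
    using ne by (auto simp: harm_log_def Let_def pow log_monom_def lookup_single when_def one G0 G1
        simp del: single_one)
qed


section \<open>The logarithmic sectors and Artinian operators\<close>

definition bounded_above_coeffs :: "(int \<Rightarrow> 'a::field_char_0) \<Rightarrow> bool" where
  "bounded_above_coeffs c \<longleftrightarrow> (\<exists>N. \<forall>b>N. c b = 0)"

text \<open>The sum of all \<open>c b * harm_log b \<alpha>\<close>; these terms have pairwise disjoint supports.\<close>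

definition harm_log_sum :: "log_index \<Rightarrow> (int \<Rightarrow> 'a::field_char_0) \<Rightarrow> 'a log_series" where
  "harm_log_sum \<alpha> c = (\<lambda>b \<beta>. c b * harm_log b \<alpha> b \<beta>)"

definition sector :: "log_index \<Rightarrow> 'a::field_char_0 log_series set" where
  "sector \<alpha> = {harm_log_sum \<alpha> c |c. bounded_above_coeffs c}"

text \<open>
  The coefficients of an element of \<open>sector \<alpha>\<close> with respect to the harmonic logarithms. The
  coefficient of a vanishing harmonic logarithm (\<open>\<alpha> = 0\<close>, \<open>b < 0\<close>) is normalised to 0.
\<close>

definition harm_coeff :: "log_index \<Rightarrow> 'a::field_char_0 log_series \<Rightarrow> int \<Rightarrow> 'a" where
  "harm_coeff \<alpha> p = (THE c. bounded_above_coeffs c \<and>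
     (\<forall>b. harm_log b \<alpha> = (\<lambda>_ _. 0 :: 'a) \<longrightarrow> c b = 0) \<and> p = harm_log_sum \<alpha> c)"

lemma harm_coeff_sum:
  fixes c :: "int \<Rightarrow> 'a::field_char_0"
  assumes "bounded_above_coeffs c" and "\<And>b. harm_log b \<alpha> = (\<lambda>_ _. 0 :: 'a) \<Longrightarrow> c b = 0"
  shows "harm_coeff \<alpha> (harm_log_sum \<alpha> c) = c"
  unfolding harm_coeff_def
proof (rule the_equality)
  fix c'
  assume c': "bounded_above_coeffs c' \<and>
    (\<forall>b. harm_log b \<alpha> = (\<lambda>_ _. 0 :: 'a) \<longrightarrow> c' b = 0) \<and> harm_log_sum \<alpha> c = harm_log_sum \<alpha> c'"
  show "c' = c"
  proof
    fix b
    show "c' b = c b"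
    proof (cases "harm_log b \<alpha> = (\<lambda>_ _. 0 :: 'a)")
      case True
      with assms c' show ?thesis by auto
    next
      case False
      then obtain d \<beta> where "harm_log b \<alpha> d \<beta> \<noteq> (0 :: 'a)"
        by (auto simp: fun_eq_iff)
      then have "harm_log b \<alpha> b \<beta> \<noteq> (0 :: 'a)"
        by (auto simp: harm_log_def split: if_splits)
      moreover have "harm_log_sum \<alpha> c b \<beta> = harm_log_sum \<alpha> c' b \<beta>"
        using c' by simp
      ultimately show ?thesis by (simp add: harm_log_sum_def)
    qed
  qed
qed (use assms in auto)

lemma harm_coeff_harm_log:
  assumes "harm_log a \<alpha> \<noteq> (\<lambda>_ _. 0 :: 'a::field_char_0)"
  shows "harm_coeff \<alpha> (harm_log a \<alpha> :: 'a log_series) = (\<lambda>b. if b = a then 1 else 0)"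
proof -
  have "harm_log a \<alpha> = harm_log_sum \<alpha> (\<lambda>b. if b = a then 1 else 0 :: 'a)"
    by (auto simp: fun_eq_iff harm_log_sum_def harm_log_def)
  moreover have "harm_coeff \<alpha> (harm_log_sum \<alpha> (\<lambda>b. if b = a then 1 else 0 :: 'a)) =
      (\<lambda>b. if b = a then 1 else 0)"
    by (rule harm_coeff_sum) (use assms in \<open>auto simp: bounded_above_coeffs_def intro: exI[of _ a]\<close>)
  ultimately show ?thesis by simp
qed

definition augmentation :: "log_index \<Rightarrow> 'a::field_char_0 log_series \<Rightarrow> 'a" where
  "augmentation \<alpha> p = harm_coeff \<alpha> p 0"

definition has_log_degree :: "log_index \<Rightarrow> 'a::field_char_0 log_series \<Rightarrow> int \<Rightarrow> bool" where
  "has_log_degree \<alpha> p a \<longleftrightarrow>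
     p \<in> sector \<alpha> \<and> harm_coeff \<alpha> p a \<noteq> 0 \<and> (\<forall>b>a. harm_coeff \<alpha> p b = 0)"

text \<open>
  Artinian operators are formal Laurent series in \<open>D = fls_X\<close>. The power \<open>D^k\<close> sends
  \<open>harm_log (b + k) \<alpha>\<close> to \<open>roman_fact (b + k) / roman_fact b\<close> times \<open>harm_log b \<alpha>\<close>, and
  only finitely many \<open>k\<close> contribute for each \<open>b\<close>. The degree of an operator is its
  \<open>fls_subdegree\<close>, and its Pincherle derivative is \<open>fls_deriv\<close>.
\<close>

definition artinian_apply ::
  "log_index \<Rightarrow> 'a::field_char_0 fls \<Rightarrow> 'a log_series \<Rightarrow> 'a log_series" where
  "artinian_apply \<alpha> f p = harm_log_sum \<alpha> (\<lambda>b.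
     \<Sum>k | fls_nth f k \<noteq> 0 \<and> harm_coeff \<alpha> p (b + k) \<noteq> 0.
       fls_nth f k * (roman_fact (b + k) / roman_fact b) * harm_coeff \<alpha> p (b + k))"

lemma artinian_apply_power:
  assumes "harm_log a \<alpha> \<noteq> (\<lambda>_ _. 0 :: 'a::field_char_0)"
  shows "artinian_apply \<alpha> (fls_X_intpow k) (harm_log a \<alpha>) =
    (\<lambda>b \<beta>. roman_fact a / roman_fact (a - k) * (harm_log (a - k) \<alpha> b \<beta> :: 'a))"
proof -
  have supp: "{j. fls_nth (fls_X_intpow k) j \<noteq> (0 :: 'a) \<and> (if b + j = a then 1 else 0) \<noteq> (0 :: 'a)} =
      (if b = a - k then {k} else {})" for b
    by auto
  have vanish: "harm_log (a - k) \<alpha> b \<beta> = (0 :: 'a)" if "b \<noteq> a - k" for b \<beta>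
    using that by (simp add: harm_log_def)
  show ?thesis
    unfolding artinian_apply_def harm_coeff_harm_log[OF assms] supp harm_log_sum_def
    by (intro ext, rename_tac b \<beta>, case_tac "b = a - k") (simp_all add: vanish)
qed

definition differential_operator :: "'a::field_char_0 fls \<Rightarrow> bool" where
  "differential_operator f \<longleftrightarrow> (\<forall>k<0. fls_nth f k = 0)"


section \<open>Graded sequences\<close>

definition regular_family :: "(int \<Rightarrow> log_index \<Rightarrow> 'a::field_char_0 log_series) \<Rightarrow> bool" where
  "regular_family p \<longleftrightarrow>
     (\<forall>a \<alpha>. p a \<alpha> \<in> sector \<alpha>) \<and>
     (\<forall>a \<alpha> \<beta>. \<alpha> \<noteq> 0 \<longrightarrow> \<beta> \<noteq> 0 \<longrightarrow> harm_coeff \<alpha> (p a \<alpha>) = harm_coeff \<beta> (p a \<beta>)) \<and>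
     (\<forall>a. p a 0 = harm_log_sum 0 (harm_coeff log_index_one (p a log_index_one)))"

text \<open>
  For \<open>\<alpha> = 0\<close> and \<open>a < 0\<close> regularity forces \<open>p a 0 = 0\<close>, so a degree can be prescribed
  only for \<open>\<alpha> \<noteq> 0\<close>; for \<open>\<alpha> = 0\<close> and \<open>a \<ge> 0\<close> degree \<open>a\<close> then follows by regularity.
\<close>

definition graded_sequence :: "(int \<Rightarrow> log_index \<Rightarrow> 'a::field_char_0 log_series) \<Rightarrow> bool" where
  "graded_sequence p \<longleftrightarrow> regular_family p \<and> (\<forall>a \<alpha>. \<alpha> \<noteq> 0 \<longrightarrow> has_log_degree \<alpha> (p a \<alpha>) a)"

definition associated_graded_sequence ::
  "'a::field_char_0 fls \<Rightarrow> (int \<Rightarrow> log_index \<Rightarrow> 'a log_series) \<Rightarrow> bool" where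
  "associated_graded_sequence f p \<longleftrightarrow>
     graded_sequence p \<and>
     (\<forall>\<alpha>. augmentation \<alpha> (p 0 \<alpha>) = 1) \<and>
     (\<forall>a \<alpha>. a \<noteq> 0 \<longrightarrow> augmentation \<alpha> (p a \<alpha>) = 0) \<and>
     (\<forall>a \<alpha>. artinian_apply \<alpha> f (p a \<alpha>) = (\<lambda>b \<beta>. of_int (roman a) * p (a - 1) \<alpha> b \<beta>))"

end

theory Submission
  imports Defs
begin

unbundle fps_syntax

text \<open>
  Sending \<open>\<Sum>b. c b * \<lambda>_b\<close> to the Laurent series \<open>\<Sum>b. roman_fact b * c b * D^(-b)\<close> turns the
  action of an Artinian operator into multiplication. If \<open>P a\<close> is the image of \<open>p_a\<close>, the
  recurrence gives \<open>P a = roman_fact a * f^(-a) * P 0\<close>, and the normalisation says that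
  \<open>f^(-a) * P 0\<close> has constant term 1 for \<open>a = 0\<close> and 0 otherwise. Since the powers of \<open>f\<close> have
  every degree, this determines \<open>P 0\<close>; and \<open>D f'/f\<close> satisfies it, because \<open>f' f^(-a-1)\<close> is a
  derivative for \<open>a \<noteq> 0\<close> and \<open>f'/f\<close> has residue \<open>fls_subdegree f = 1\<close>.
\<close>

section \<open>Laurent series\<close>

text \<open>The convolution is summed over the indices where both factors are nonzero, because this
  is the index set that occurs in \<open>artinian_apply\<close>.\<close>

lemma fls_times_nth_support:
  fixes f g :: "'a::semiring_0 fls"
  shows "(f * g) $$ n = (\<Sum>k | f $$ k \<noteq> 0 \<and> g $$ (n - k) \<noteq> 0. f $$ k * g $$ (n - k))"
proof -
  have "f $$ k \<noteq> 0 \<Longrightarrow> fls_subdegree f \<le> k" "g $$ k \<noteq> 0 \<Longrightarrow> fls_subdegree g \<le> k" for k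
    by (auto intro: fls_subdegree_leI)
  then have "{k. f $$ k \<noteq> 0 \<and> g $$ (n - k) \<noteq> 0} \<subseteq> {fls_subdegree f..n - fls_subdegree g}"
    by force
  then show ?thesis
    unfolding fls_times_nth(2) by (intro sum.mono_neutral_right) auto
qed

lemma fls_deriv_power_int:
  fixes f :: "'a::field fls"
  assumes "f \<noteq> 0"
  shows "fls_deriv (f powi n) = of_int n * f powi (n - 1) * fls_deriv f"
proof -
  have pos: "fls_deriv (f ^ m) = of_nat m * f powi (int m - 1) * fls_deriv f" for m
    by (cases m) (simp_all add: fls_deriv_power del: power_Suc)
  show ?thesis
  proof (cases n rule: int_cases2)
    case (nonneg m)
    then show ?thesis by (simp add: pos)
  next
    case (nonpos m)
    have "f powi (- int m - 1) = f powi (int m - 1) * (inverse (f ^ m))\<^sup>2"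
      using assms by (simp add: power_int_minus power_int_diff field_simps power2_eq_square)
    then show ?thesis
      by (simp add: nonpos power_int_minus fls_inverse_deriv pos mult_ac)
  qed
qed

lemma residue_log_deriv_power_int:
  fixes f :: "'a::field_char_0 fls"
  assumes "f \<noteq> 0"
  shows "(f powi a * (fls_deriv f / f)) $$ (- 1) = (if a = 0 then of_int (fls_subdegree f) else 0)"
proof (cases "a = 0")
  case True
  then show ?thesis
    using fls_residue_deriv_times_inverse_eq_subdegree(1)[of f] by (simp add: field_class.field_divide_inverse)
next
  case False
  \<comment> \<open>Derivatives have residue zero, and the factor \<open>a\<close> cancels in
    characteristic zero.\<close>
  have "fls_deriv (f powi a) = of_int a * (f powi a * (fls_deriv f / f))"
    using assms by (simp add: fls_deriv_power_int power_int_diff)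
  then have "of_int a * fls_residue (f powi a * (fls_deriv f / f)) = 0"
    by (metis fls_residue_deriv fls_residue_of_int_times(1))
  with False show ?thesis by simp
qed

text \<open>The residue lemma shows that the right-hand side satisfies the same conditions, so only
  uniqueness is left. The difference \<open>E\<close> of two solutions has no constant term after
  multiplication by any power of \<open>f\<close>. As \<open>f\<close> has degree one, some power
  would move the leading term of a nonzero \<open>E\<close> to degree 0.\<close>

lemma const_term_powers_unique:
  fixes f :: "'a::field_char_0 fls"
  assumes f: "fls_subdegree f = 1"
    and Q: "\<And>a. (f powi a * Q) $$ 0 = (if a = 0 then 1 else 0)"
  shows "Q = fls_X * fls_deriv f / f"
proof -
  define E where "E = Q - fls_X * fls_deriv f / f"
  have f0: "f \<noteq> 0" using f by auto
  have "(f powi a * (fls_X * fls_deriv f / f)) $$ 0 = (if a = 0 then 1 else 0)" for a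
  proof -
    have "f powi a * (fls_X * fls_deriv f / f) = fls_X * (f powi a * (fls_deriv f / f))"
      by (simp add: field_simps)
    \<comment> \<open>Multiplication by \<open>fls_X\<close> moves the residue to the constant
      term.\<close>
    then show ?thesis
      using residue_log_deriv_power_int[OF f0, of a] f
      by (simp only: fls_X_times_conv_shift) simp
  qed
  with Q have E: "(f powi a * E) $$ 0 = 0" for a
    by (simp add: E_def right_diff_distrib)
  have "E = 0"
  proof (rule ccontr)
    assume "E \<noteq> 0"
    then have nz: "f powi (- fls_subdegree E) * E \<noteq> 0" using f0 by simp
    moreover have "fls_subdegree (f powi (- fls_subdegree E) * E) = 0"
      using \<open>E \<noteq> 0\<close> f0 f by simp
    ultimately show False using E nth_fls_subdegree_nonzero by metis
  qed
  then show ?thesis by (simp add: E_def)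
qed


section \<open>Sectors as Laurent series\<close>

lemma roman_fact_nonzero: "roman_fact a \<noteq> (0 :: 'a::field_char_0)"
  by (simp add: roman_fact_def)

text \<open>The convention \<open>roman 0 = 1\<close> carries the recurrence across zero, since
  \<open>roman_fact 0\<close> and \<open>roman_fact (-1)\<close> are both 1.\<close>

lemma roman_fact_rec: "roman_fact a = of_int (roman a) * (roman_fact (a - 1) :: 'a::field_char_0)"
proof -
  consider "a > 0" | "a = 0" | "a < 0" by linarith
  then show ?thesis
  proof cases
    case 1
    then obtain n where "a = int (Suc n)" by (metis zero_less_imp_eq_int gr0_implies_Suc)
    then have "nat a = Suc n" "nat (a - 1) = n" "of_int a = (of_nat (Suc n) :: 'a)"
      by simp_all
    with 1 show ?thesis by (simp add: roman_fact_def roman_def)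
  next
    case 2
    then show ?thesis by (simp add: roman_fact_def roman_def)
  next
    case 3
    define n where "n = nat (- a - 1)"
    have "a = - int (Suc n)" using 3 by (simp add: n_def)
    then have "nat (- a) = Suc n" "nat (- a - 1) = n" "of_int a = (- of_nat (Suc n) :: 'a)"
      by simp_all
    with 3 show ?thesis
      by (simp add: roman_fact_def roman_def del: of_nat_Suc)
  qed
qed

lemma inj_index_upto: "inj index_upto"
proof (rule injI)
  fix i j assume "index_upto i = index_upto j"
  then have "Poly_Mapping.lookup (index_upto i) k = Poly_Mapping.lookup (index_upto j) k" for k
    by simp
  from this[of i] this[of j] show "i = j"
    by (auto simp: lookup_index_upto split: if_splits)
qed

text \<open>For \<open>a \<ge> 0\<close> the generator has constant term 1, so the monomial with
  index \<alpha> survives. For \<open>a < 0\<close> the generator starts with \<open>fps_X\<close>,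
  so one Euler derivation is applied first; a nonzero entry \<open>i\<close> of \<alpha> then leaves
  a nonzero term at \<open>\<alpha> - index_upto i\<close>.\<close>

lemma harm_log_nonzero:
  assumes "\<alpha> \<noteq> 0"
  shows "harm_log a \<alpha> \<noteq> (\<lambda>_ _. 0 :: 'a::field_char_0)"
proof (cases "a \<ge> 0")
  case True
  then have "harm_log a \<alpha> a \<alpha> = (1 :: 'a)"
    by (simp add: harm_log_def harm_log_gen_def prod_nth_0)
  then show ?thesis by (metis zero_neq_one)
next
  case False
  from assms obtain i where i: "Poly_Mapping.lookup \<alpha> i \<noteq> 0"
    by (metis poly_mapping_eqI lookup_zero)
  let ?\<beta> = "\<alpha> - index_upto i"
  have "{j. Poly_Mapping.lookup (Poly_Mapping.single \<alpha> (1::'a)) (?\<beta> + index_upto j) \<noteq> 0} = {i}"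
    using inj_index_upto by (auto simp: lookup_single when_def inj_def algebra_simps)
  then have "Poly_Mapping.lookup (euler_log (Poly_Mapping.single \<alpha> (1::'a))) ?\<beta> =
      of_int (Poly_Mapping.lookup \<alpha> i)"
    by (simp add: lookup_euler_log lookup_minus lookup_index_upto)
  then have "harm_log a \<alpha> a ?\<beta> = (of_int (Poly_Mapping.lookup \<alpha> i) :: 'a)"
    using False
    by (simp add: harm_log_def harm_log_gen_def prod_nth_0 lookup_minus lookup_index_upto)
  with i show ?thesis by (metis of_int_eq_0_iff)
qed

text \<open>Negating exponents turns a bound above on the support of \<open>c\<close> into the bound
  below that a Laurent series requires; for other \<open>c\<close> the value of
  \<open>Abs_fls\<close> carries no meaning.\<close>

definition roman_fls :: "(int \<Rightarrow> 'a::field_char_0) \<Rightarrow> 'a fls" where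
  "roman_fls c = Abs_fls (\<lambda>n. roman_fact (- n) * c (- n))"

lemma roman_fls_nth:
  assumes "bounded_above_coeffs c"
  shows "roman_fls c $$ n = roman_fact (- n) * c (- n)"
proof -
  from assms obtain N where N: "\<forall>b>N. c b = 0" by (auto simp: bounded_above_coeffs_def)
  show ?thesis unfolding roman_fls_def
    by (rule nth_Abs_fls_lower_bound[of "- N"]) (use N in auto)
qed

lemma roman_fls_scale:
  assumes "bounded_above_coeffs c"
  shows "roman_fls (\<lambda>b. of_int r * c b) = of_int r * roman_fls c"
proof (rule fls_eqI)
  fix n
  have "bounded_above_coeffs (\<lambda>b. of_int r * c b)"
    using assms by (auto simp: bounded_above_coeffs_def)
  then show "roman_fls (\<lambda>b. of_int r * c b) $$ n = (of_int r * roman_fls c) $$ n"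
    by (simp add: roman_fls_nth assms fls_of_int[symmetric] del: fls_of_int)
qed

lemma roman_fls_delta:
  "roman_fls (\<lambda>b. if b = a then 1 else 0) = fls_const (roman_fact a) * fls_X_intpow (- a)"
proof (rule fls_eqI)
  fix n
  have "bounded_above_coeffs (\<lambda>b. if b = a then 1 else 0 :: 'a)"
    by (auto simp: bounded_above_coeffs_def intro: exI[of _ a])
  then show "roman_fls (\<lambda>b. if b = a then 1 else 0) $$ n =
      (fls_const (roman_fact a) * fls_X_intpow (- a) :: 'a fls) $$ n"
    by (cases "n = - a") (auto simp: roman_fls_nth)
qed

text \<open>The inverse of \<open>roman_fls\<close> on coefficient families that are bounded
  above.\<close>

definition fls_coeffs :: "'a::field_char_0 fls \<Rightarrow> int \<Rightarrow> 'a" where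
  "fls_coeffs F b = F $$ (- b) / roman_fact b"

lemma bounded_above_fls_coeffs: "bounded_above_coeffs (fls_coeffs F)"
  unfolding bounded_above_coeffs_def fls_coeffs_def
  by (intro exI[of _ "- fls_subdegree F"]) auto

lemma roman_fls_fls_coeffs: "roman_fls (fls_coeffs F) = F"
  by (rule fls_eqI) (simp add: roman_fls_nth bounded_above_fls_coeffs fls_coeffs_def roman_fact_nonzero)

lemma fls_coeffs_roman_fls: "bounded_above_coeffs c \<Longrightarrow> fls_coeffs (roman_fls c) = c"
  by (rule ext) (simp add: roman_fls_nth fls_coeffs_def roman_fact_nonzero)

text \<open>In the ratio \<open>roman_fact (b + k) / roman_fact b\<close> the numerator is absorbed
  by \<open>roman_fls\<close> and the denominator by \<open>fls_coeffs\<close>. What remains is the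
  convolution at exponent \<open>- b\<close>.\<close>

lemma artinian_apply_eq_mult:
  assumes "bounded_above_coeffs (harm_coeff \<alpha> p)"
  shows "artinian_apply \<alpha> g p = harm_log_sum \<alpha> (fls_coeffs (g * roman_fls (harm_coeff \<alpha> p)))"
  unfolding artinian_apply_def fls_coeffs_def fls_times_nth_support
  by (simp add: roman_fls_nth[OF assms] roman_fact_nonzero sum_divide_distrib algebra_simps)

text \<open>For nonzero \<alpha> no harmonic logarithm vanishes, so the normalisation in
  \<open>harm_coeff\<close> is no restriction and any representing family is the coefficient
  family.\<close>

lemma
  assumes "\<alpha> \<noteq> 0" and "q \<in> sector \<alpha>"
  shows bounded_above_harm_coeff: "bounded_above_coeffs (harm_coeff \<alpha> q)"
    and harm_log_sum_harm_coeff: "harm_log_sum \<alpha> (harm_coeff \<alpha> q) = q"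
proof -
  from assms(2) obtain c where c: "bounded_above_coeffs c" "q = harm_log_sum \<alpha> c"
    by (auto simp: sector_def)
  then have "harm_coeff \<alpha> q = c"
    using harm_coeff_sum harm_log_nonzero[OF assms(1)] by blast
  with c show "bounded_above_coeffs (harm_coeff \<alpha> q)" "harm_log_sum \<alpha> (harm_coeff \<alpha> q) = q"
    by simp_all
qed

text \<open>Assuming only that this one harmonic logarithm is nonzero lets the formula cover index 0
  with \<open>a \<ge> 0\<close> as well.\<close>

lemma artinian_apply_harm_log:
  assumes "harm_log a \<alpha> \<noteq> (\<lambda>_ _. 0 :: 'a::field_char_0)"
  shows "artinian_apply \<alpha> g (harm_log a \<alpha> :: 'a log_series) =
    harm_log_sum \<alpha> (fls_coeffs (g * (fls_const (roman_fact a) * fls_X_intpow (- a))))"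
proof -
  note c = harm_coeff_harm_log[OF assms]
  have "bounded_above_coeffs (harm_coeff \<alpha> (harm_log a \<alpha> :: 'a log_series))"
    unfolding c by (auto simp: bounded_above_coeffs_def intro: exI[of _ a])
  then show ?thesis
    by (simp only: artinian_apply_eq_mult c roman_fls_delta)
qed


section \<open>The associated graded sequence\<close>

lemma associated_graded_sequence_coeffs:
  fixes f :: "'a::field_char_0 fls"
  assumes f: "fls_subdegree f = 1" and p: "associated_graded_sequence f p" and \<alpha>: "\<alpha> \<noteq> 0"
  shows "harm_coeff \<alpha> (p a \<alpha>) = fls_coeffs
    (fls_deriv f * (fls_X / f) powi (a + 1) * (fls_const (roman_fact a) * fls_X_intpow (- a)))"
proof -
  define P where "P a = roman_fls (harm_coeff \<alpha> (p a \<alpha>))" for a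
  have f0: "f \<noteq> 0" using f by auto
  have sec: "p a \<alpha> \<in> sector \<alpha>" for a
    using p by (auto simp: associated_graded_sequence_def graded_sequence_def regular_family_def)
  note bd = bounded_above_harm_coeff[OF \<alpha> sec]
  have coeff_sum: "harm_coeff \<alpha> (harm_log_sum \<alpha> c) = c" if "bounded_above_coeffs c"
    for c :: "int \<Rightarrow> 'a"
    using that harm_log_nonzero[OF \<alpha>] by (intro harm_coeff_sum) auto
  have rec: "f * P a = of_int (roman a) * P (a - 1)" for a
  proof -
    let ?c = "\<lambda>b. of_int (roman a) * harm_coeff \<alpha> (p (a - 1) \<alpha>) b"
    have "harm_log_sum \<alpha> (fls_coeffs (f * P a)) = artinian_apply \<alpha> f (p a \<alpha>)"
      by (simp add: artinian_apply_eq_mult bd P_def)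
    also have "\<dots> = (\<lambda>b \<beta>. of_int (roman a) * p (a - 1) \<alpha> b \<beta>)"
      using p by (simp add: associated_graded_sequence_def)
    also have "\<dots> = (\<lambda>b \<beta>. of_int (roman a) *
        harm_log_sum \<alpha> (harm_coeff \<alpha> (p (a - 1) \<alpha>)) b \<beta>)"
      by (simp only: harm_log_sum_harm_coeff[OF \<alpha> sec])
    also have "\<dots> = harm_log_sum \<alpha> ?c"
      by (simp add: harm_log_sum_def mult.assoc)
    finally have "harm_coeff \<alpha> (harm_log_sum \<alpha> (fls_coeffs (f * P a))) =
        harm_coeff \<alpha> (harm_log_sum \<alpha> ?c)"
      by simp
    moreover have "bounded_above_coeffs ?c"
      using bd[of "a - 1"] by (auto simp: bounded_above_coeffs_def)
    ultimately have "fls_coeffs (f * P a) = ?c"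
      by (simp only: coeff_sum bounded_above_fls_coeffs)
    then have "roman_fls (fls_coeffs (f * P a)) = roman_fls ?c"
      by simp
    then show ?thesis
      by (simp only: roman_fls_fls_coeffs roman_fls_scale[OF bd] P_def)
  qed
  \<comment> \<open>Induction in both directions from 0: the upward step divides by
    \<open>f\<close>, the downward step by \<open>roman i\<close>, which is never zero.\<close>
  have P: "P a = fls_const (roman_fact a) * f powi (- a) * P 0" for a
  proof (induction a rule: int_induct[where k = 0])
    case base
    show ?case by (simp add: roman_fact_def)
  next
    case (step1 i)
    have "f * P (i + 1) = of_int (roman (i + 1)) * P i"
      using rec[of "i + 1"] by simp
    also have "\<dots> = fls_const (of_int (roman (i + 1)) * roman_fact i) * f powi (- i) * P 0"
      by (simp add: step1 fls_of_int[symmetric] fls_const_mult_const[symmetric] mult.assoc del: fls_const_mult_const fls_of_int)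
    also have "of_int (roman (i + 1)) * roman_fact i = (roman_fact (i + 1) :: 'a)"
      using roman_fact_rec[of "i + 1", where 'a = 'a] by simp
    finally have "P (i + 1) = fls_const (roman_fact (i + 1)) * (f powi (- i) / f) * P 0"
      using f0 by (simp add: field_simps)
    moreover have "f powi (- i) / f = f powi (- (i + 1))"
      using f0 by (simp add: power_int_diff)
    ultimately show ?case by simp
  next
    case (step2 i)
    have r: "of_int (roman i) \<noteq> (0 :: 'a fls)" "of_int (roman i) \<noteq> (0 :: 'a)"
      by (simp_all add: roman_def)
    have "of_int (roman i) * P (i - 1) = f * (fls_const (roman_fact i) * f powi (- i) * P 0)"
      using rec[of i] by (simp add: step2)
    also have "fls_const (roman_fact i) = (of_int (roman i) * fls_const (roman_fact (i - 1)) :: 'a fls)"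
      by (subst roman_fact_rec) (simp add: fls_of_int)
    finally have "P (i - 1) = fls_const (roman_fact (i - 1)) * (f * f powi (- i)) * P 0"
      using r by (simp add: mult_ac)
    moreover have "f * f powi (- i) = f powi (- (i - 1))"
      using f0 by (simp add: power_int_diff power_int_minus field_simps)
    ultimately show ?case by simp
  qed
  \<comment> \<open>The constant term of \<open>P a\<close> is the augmentation times
    \<open>roman_fact 0 = 1\<close>.\<close>
  have "P a $$ 0 = (if a = 0 then 1 else 0)" for a
    using p by (auto simp: P_def roman_fls_nth bd roman_fact_def
        associated_graded_sequence_def augmentation_def)
  moreover have "P (- a) $$ 0 = roman_fact (- a) * (f powi a * P 0) $$ 0" for a
    by (subst P) (simp add: mult.assoc)
  \<comment> \<open>The sign of \<open>a\<close> is reversed to bring the powers of \<open>f\<close>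
    into the form that \<open>const_term_powers_unique\<close> expects.\<close>
  ultimately have "roman_fact (- a) * (f powi a * P 0) $$ 0 = (if a = 0 then 1 else 0)" for a
    by (metis neg_equal_0_iff_equal)
  then have "(f powi a * P 0) $$ 0 = (if a = 0 then 1 else 0)" for a
    using roman_fact_nonzero[of "- a", where 'a = 'a]
    by (cases "a = 0") (force simp: roman_fact_def dest: spec[of _ a])+
  then have "P 0 = fls_X * fls_deriv f / f"
    by (rule const_term_powers_unique[OF f])
  moreover have x: "fls_X_intpow (- a) = inverse (fls_X powi a :: 'a fls)" "fls_X powi a \<noteq> (0 :: 'a fls)"
    by (metis fls_X_power_int power_int_minus) simp
  \<comment> \<open>The surplus power in \<open>fls_X powi (a + 1)\<close> cancels against the image
    of the harmonic logarithm, leaving the single \<open>fls_X\<close> of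
    \<open>P 0\<close>.\<close>
  ultimately have "P a = fls_deriv f * (fls_X / f) powi (a + 1) *
      (fls_const (roman_fact a) * fls_X_intpow (- a))"
    using f0 x
    by (subst P) (simp add: power_int_divide_distrib power_int_minus power_int_add field_simps
        del: fls_X_power_int)
  moreover have "harm_coeff \<alpha> (p a \<alpha>) = fls_coeffs (P a)"
    by (simp add: P_def fls_coeffs_roman_fls bd)
  ultimately show ?thesis by simp
qed

theorem mainTheorem12:
  fixes f :: "'a::field_char_0 fls"
    and p :: "int \<Rightarrow> log_index \<Rightarrow> 'a log_series"
  assumes "differential_operator f"
    and "fls_subdegree f = 1"
    and "associated_graded_sequence f p"
  shows "(\<forall>a \<alpha>. p a \<alpha> =
            artinian_apply \<alpha> (fls_deriv f * (fls_X / f) powi (a + 1)) (harm_log a \<alpha>)) \<and>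
         p (- 1) log_index_one =
            artinian_apply log_index_one (fls_deriv f) (log_monom (- 1) 0)"
proof -
  let ?g = "\<lambda>a. fls_deriv f * (fls_X / f) powi (a + 1)"
  note coeffs = associated_graded_sequence_coeffs[OF assms(2,3)]
  have sec: "p a \<alpha> \<in> sector \<alpha>" for a \<alpha>
    using assms(3)
    by (auto simp: associated_graded_sequence_def graded_sequence_def regular_family_def)
  from assms(3) have graded: "graded_sequence p" by (simp add: associated_graded_sequence_def)
  then have reg: "regular_family p" by (simp add: graded_sequence_def)
  have one: "log_index_one \<noteq> 0"
    using lookup_single_eq[of 0 "1 :: int"] unfolding log_index_one_def by (intro notI) simp
  have main: "p a \<alpha> = artinian_apply \<alpha> (?g a) (harm_log a \<alpha>)" for a \<alpha>
  proof (cases "\<alpha> = 0")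
    case False
    then have "p a \<alpha> = harm_log_sum \<alpha> (harm_coeff \<alpha> (p a \<alpha>))"
      using sec by (simp add: harm_log_sum_harm_coeff)
    with False show ?thesis
      by (simp only: coeffs artinian_apply_harm_log harm_log_nonzero not_False_eq_True)
  next
    case True
    \<comment> \<open>Regularity transfers the coefficients from index (1), where they are already
      known.\<close>
    have p0: "p a 0 = harm_log_sum 0 (harm_coeff log_index_one (p a log_index_one))"
      using reg unfolding regular_family_def by blast
    show ?thesis
    proof (cases "a \<ge> 0")
      case a: True
      have "harm_log a 0 \<noteq> (\<lambda>_ _. 0 :: 'a)"
        using a by (auto simp: harm_log_index_zero log_monom_def fun_eq_iff)
      from artinian_apply_harm_log[OF this] show ?thesis
        unfolding True p0 by (simp only: coeffs[OF one])
    next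
      case False
      \<comment> \<open>For index 0 and negative \<open>a\<close> both sides vanish: only harmonic
        logarithms of negative degree occur in \<open>p a 0\<close>, and these are zero, as is
        \<open>harm_log a 0\<close>.\<close>
      have zero: "harm_log_sum 0 c = (\<lambda>_ _. 0 :: 'a)" if "\<And>b. b \<ge> 0 \<Longrightarrow> c b = 0" for c
        using that by (auto simp: harm_log_sum_def harm_log_index_zero fun_eq_iff not_le)
      have "has_log_degree log_index_one (p a log_index_one) a"
        using graded one by (simp add: graded_sequence_def)
      with False have "p a 0 = (\<lambda>_ _. 0)"
        unfolding p0 by (intro zero) (auto simp: has_log_degree_def)
      moreover have "harm_coeff 0 (\<lambda>_ _. 0 :: 'a) = (\<lambda>_. 0)"
        using harm_coeff_sum[of "\<lambda>_. 0 :: 'a" 0] zero[of "\<lambda>_. 0"]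
        by (simp add: bounded_above_coeffs_def)
      then have "artinian_apply 0 (?g a) (\<lambda>_ _. 0) = (\<lambda>_ _. 0)"
        by (simp add: artinian_apply_def zero)
      ultimately show ?thesis
        using False by (simp add: True harm_log_index_zero)
    qed
  qed
  \<comment> \<open>At \<open>a = - 1\<close> the exponent \<open>a + 1\<close> is 0, so only the
    Pincherle derivative remains.\<close>
  moreover have "harm_log (- 1) log_index_one = (log_monom (- 1) 0 :: 'a log_series)"
    by (simp add: harm_log_index_one)
  ultimately show ?thesis
    using main[of "- 1" log_index_one] by simp
qed

end
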